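(* Let the number of groups $m$, the doubling dimension $\lambda$ and $\epsilon\in(0,1]$ be constants. Given an instance $(\mathcal{X},d)$, $\mathcal{X}=\bigcup_{i=1}^m\mathcal{X}_i$, $k_1,\dots,k_m$ of Fair Max-Min diversification whose metric has doubling dimension $\lambda$ (in particular, points in Euclidean space of constant dimension), with $|\mathcal{X}|=n$ and $k=\sum_i k_i$, one can obtain a $(1+\epsilon)$-approximation with perfect fairness, i.e. a set $\mathcal{S}\subseteq\mathcal{X}$ with $\mathrm{div}(\mathcal{S})\ge\ell^*/(1+\epsilon)$ and $|\mathcal{S}\cap\mathcal{X}_i|\ge k_i$ for all $i\in[m]$, by enumerating over all subsets of the coreset $\mathcal{T}$ described in the context and returning the subset with maximum diversity and perfect fairness. The running time of this algorithm is $O(nk)+2^{O(k)}$.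
   Context: Fair Max-Min diversification: the input is a metric space $(\mathcal{X},d)$ with $|\mathcal{X}|=n$, where $\mathcal{X}=\bigcup_{i=1}^m\mathcal{X}_i$ is partitioned into $m$ disjoint groups, and non-negative integers $k_1,\dots,k_m$ with $k_i\le|\mathcal{X}_i|$. For $\mathcal{S}\subseteq\mathcal{X}$ let $\mathrm{div}(\mathcal{S})=\min_{u,v\in\mathcal{S},u\ne v}d(u,v)$. The optimal diversity is $\ell^*=\max\{\mathrm{div}(\mathcal{S}):\mathcal{S}\subseteq\mathcal{X},\ |\mathcal{S}\cap\mathcal{X}_i|=k_i\ \forall i\in[m]\}$. Doubling dimension: write $\mathbf{B}(p,r)=\{q\in\mathcal{X}: d(p,q)<r\}$. The doubling dimension of $\mathcal{X}$ is the smallest integer $\lambda$ such that any ball $\mathbf{B}(p,r)$ of radius $r$ around a point $p\in\mathcal{X}$ can be covered using at most $(r/r')^\lambda$ balls of radius $r'$. Coreset: $\mathrm{GMM}(\mathcal{Y},s)$ is the greedy algorithm that starts with an arbitrary point of $\mathcal{Y}$ and in every subsequent step selects the point of $\mathcal{Y}$ farthest away from the previously selected points, until $s$ points are selected. With $\epsilon'=\epsilon/(1+\epsilon)$, let $T_i=\mathrm{GMM}(\mathcal{X}_i,(4/\epsilon')^\lambda k)$ and $\mathcal{T}=\bigcup_{i=1}^m T_i$. This $\mathcal{T}$ is a $(1+\epsilon)$-coreset, i.e. it contains a subset $\mathcal{T}'$ with $|\mathcal{T}'\cap\mathcal{X}_i|=k_i$ for all $i$ and $\mathrm{div}(\ma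thcal{T}')\ge\ell^*/(1+\epsilon)$.
   Formalization: The covering condition in the doubling dimension is required only for radii r' ≤ r/2; for unrestricted r' no finite metric space with two or more points would have a doubling dimension. *)

theory Defs
  imports "HOL-Analysis.Analysis" "HOL-Library.Landau_Symbols" "HOL-Library.Monad_Syntax"
begin

text \<open>The groups are \<open>X 0, \<dots>, X (m - 1)\<close> and the requirements \<open>k 0, \<dots>, k (m - 1)\<close>.\<close>

definition ground :: "nat \<Rightarrow> (nat \<Rightarrow> 'a set) \<Rightarrow> 'a set" where
  "ground m X = (\<Union>i<m. X i)"

definition fair_instance ::
  "nat \<Rightarrow> ('a \<Rightarrow> 'a \<Rightarrow> real) \<Rightarrow> (nat \<Rightarrow> 'a set) \<Rightarrow> (nat \<Rightarrow> nat) \<Rightarrow> bool" where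
  "fair_instance m d X k \<longleftrightarrow>
     finite (ground m X) \<and> Metric_space (ground m X) d \<and>
     disjoint_family_on X {..<m} \<and> (\<forall>i<m. k i \<le> card (X i))"

text \<open>The minimum over the empty set of pairs is \<open>\<infinity>\<close>, so sets with at most one point have
  infinite diversity.\<close>

definition diversity :: "('a \<Rightarrow> 'a \<Rightarrow> real) \<Rightarrow> 'a set \<Rightarrow> ereal" where
  "diversity d S = (INF (u, v) \<in> {(u, v). u \<in> S \<and> v \<in> S \<and> u \<noteq> v}. ereal (d u v))"

definition opt_diversity ::
  "nat \<Rightarrow> ('a \<Rightarrow> 'a \<Rightarrow> real) \<Rightarrow> (nat \<Rightarrow> 'a set) \<Rightarrow> (nat \<Rightarrow> nat) \<Rightarrow> ereal" where
  "opt_diversity m d X k =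
     Max (diversity d ` {S. S \<subseteq> ground m X \<and> (\<forall>i<m. card (S \<inter> X i) = k i)})"

text \<open>The covering condition is imposed for radii \<open>r' \<le> r / 2\<close>. Without such a separation it
  would be degenerate: for \<open>r / r'\<close> close to \<open>1\<close> the bound \<open>(r / r') ^ \<lambda>\<close> is less than \<open>2\<close>, so
  every ball would lie in a single smaller ball, and iterating this no finite metric space
  with two points would satisfy the condition for any \<open>\<lambda>\<close>.\<close>

definition covering_exponent :: "'a set \<Rightarrow> ('a \<Rightarrow> 'a \<Rightarrow> real) \<Rightarrow> nat \<Rightarrow> bool" where
  "covering_exponent M d lam \<longleftrightarrow>
     (\<forall>p\<in>M. \<forall>r r'. 0 < r' \<and> r' \<le> r / 2 \<longrightarrow>
        (\<exists>C. C \<subseteq> M \<and> finite C \<and> real (card C) \<le> (r / r') ^ lam \<and>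
             Metric_space.mball M d p r \<subseteq> (\<Union>c\<in>C. Metric_space.mball M d c r')))"

definition doubling_dim :: "'a set \<Rightarrow> ('a \<Rightarrow> 'a \<Rightarrow> real) \<Rightarrow> nat" where
  "doubling_dim M d = (LEAST lam. covering_exponent M d lam)"

text \<open>A timed computation is a value together with the number of steps. One step is charged for
  every call of a recursive procedure and for every evaluation of the metric. Outside
  its recursive and procedure calls, a procedure body performs only a constant number of
  constructor, comparison and arithmetic operations, so the count is, up to a constant
  factor, the unit-cost running time.\<close>

type_synonym 'a timed = "'a \<times> nat"

definition ret :: "'a \<Rightarrow> 'a timed" where
  "ret x = (x, 0)"

definition tick :: "'a timed \<Rightarrow> 'a timed" where
  "tick c = (fst c, Suc (snd c))"

definition bind_timed :: "'a timed \<Rightarrow> ('a \<Rightarrow> 'b timed) \<Rightarrow> 'b timed" where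
  "bind_timed c f = (fst (f (fst c)), snd c + snd (f (fst c)))"

adhoc_overloading Monad_Syntax.bind \<rightleftharpoons> bind_timed

definition query :: "('a \<Rightarrow> 'a \<Rightarrow> real) \<Rightarrow> 'a \<Rightarrow> 'a \<Rightarrow> real timed" where
  "query d p q = tick (ret (d p q))"

text \<open>\<open>map_timed\<close> is used below only with functions \<open>f\<close> of constant cost.\<close>

fun map_timed :: "('a \<Rightarrow> 'b) \<Rightarrow> 'a list \<Rightarrow> 'b list timed" where
  "map_timed f [] = tick (ret [])"
| "map_timed f (x # xs) = tick (do { ys \<leftarrow> map_timed f xs; ret (f x # ys) })"

fun append_timed :: "'a list \<Rightarrow> 'a list \<Rightarrow> 'a list timed" where
  "append_timed [] ys = tick (ret ys)"
| "append_timed (x # xs) ys = tick (do { zs \<leftarrow> append_timed xs ys; ret (x # zs) })"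

fun sum_timed :: "nat list \<Rightarrow> nat timed" where
  "sum_timed [] = tick (ret 0)"
| "sum_timed (x # xs) = tick (do { s \<leftarrow> sum_timed xs; ret (x + s) })"

text \<open>The unselected points are stored together with their distance to the set of selected
  points, initially \<open>\<infinity>\<close>. \<open>extract_max\<close> removes an entry with the largest distance.\<close>

fun extract_max :: "'a \<times> ereal \<Rightarrow> ('a \<times> ereal) list \<Rightarrow> (('a \<times> ereal) \<times> ('a \<times> ereal) list) timed" where
  "extract_max b [] = tick (ret (b, []))"
| "extract_max b (c # cs) = tick (
     if snd b < snd c
     then do { (b', cs') \<leftarrow> extract_max c cs; ret (b', b # cs') }
     else do { (b', cs') \<leftarrow> extract_max b cs; ret (b', c # cs') })"

fun relax :: "('a \<Rightarrow> 'a \<Rightarrow> real) \<Rightarrow> 'a \<Rightarrow> ('a \<times> ereal) list \<Rightarrow> ('a \<times> ereal) list timed" where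
  "relax d p [] = tick (ret [])"
| "relax d p ((q, e) # cs) = tick (do {
     e' \<leftarrow> query d p q;
     cs' \<leftarrow> relax d p cs;
     ret ((q, min e (ereal e')) # cs') })"

fun gmm_loop :: "('a \<Rightarrow> 'a \<Rightarrow> real) \<Rightarrow> nat \<Rightarrow> ('a \<times> ereal) list \<Rightarrow> 'a list timed" where
  "gmm_loop d 0 cs = tick (ret [])"
| "gmm_loop d (Suc s) [] = tick (ret [])"
| "gmm_loop d (Suc s) (c # cs) = tick (do {
     ((p, e), rest) \<leftarrow> extract_max c cs;
     rest' \<leftarrow> relax d p rest;
     ps \<leftarrow> gmm_loop d s rest';
     ret (p # ps) })"

text \<open>The arbitrary choices of GMM are resolved by the order of the input list: the first point is
  selected first, and ties are broken in favour of earlier entries. Listing the points in the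
  order of any given greedy run, followed by the remaining points, reproduces that run. If
  there are fewer than \<open>s\<close> points, all of them are selected.\<close>

definition gmm :: "('a \<Rightarrow> 'a \<Rightarrow> real) \<Rightarrow> nat \<Rightarrow> 'a list \<Rightarrow> 'a list timed" where
  "gmm d s ys = tick (
     if s = 0 then ret [] else do { cs \<leftarrow> map_timed (\<lambda>y. (y, \<infinity>)) ys; gmm_loop d s cs })"

text \<open>The points of the coreset are tagged with the index of their group, starting from \<open>i\<close>.\<close>

fun coreset :: "('a \<Rightarrow> 'a \<Rightarrow> real) \<Rightarrow> nat \<Rightarrow> nat \<Rightarrow> 'a list list \<Rightarrow> (nat \<times> 'a) list timed" where
  "coreset d s i [] = tick (ret [])"
| "coreset d s i (Y # Ys) = tick (do {
     T \<leftarrow> gmm d s Y;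
     L \<leftarrow> map_timed (Pair i) T;
     R \<leftarrow> coreset d s (Suc i) Ys;
     append_timed L R })"

fun subsets :: "'a list \<Rightarrow> 'a list list timed" where
  "subsets [] = tick (ret [[]])"
| "subsets (x # xs) = tick (do {
     Ss \<leftarrow> subsets xs;
     Ss' \<leftarrow> map_timed (Cons x) Ss;
     append_timed Ss' Ss })"

fun count_group :: "nat \<Rightarrow> (nat \<times> 'a) list \<Rightarrow> nat timed" where
  "count_group i [] = tick (ret 0)"
| "count_group i (p # ps) = tick (do {
     c \<leftarrow> count_group i ps;
     ret (if fst p = i then Suc c else c) })"

fun check_fair :: "nat \<Rightarrow> nat list \<Rightarrow> (nat \<times> 'a) list \<Rightarrow> bool timed" where
  "check_fair i [] S = tick (ret True)"
| "check_fair i (k # ks) S = tick (do {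
     c \<leftarrow> count_group i S;
     b \<leftarrow> check_fair (Suc i) ks S;
     ret (k \<le> c \<and> b) })"

fun dist_to_list :: "('a \<Rightarrow> 'a \<Rightarrow> real) \<Rightarrow> 'a \<Rightarrow> 'a list \<Rightarrow> ereal timed" where
  "dist_to_list d p [] = tick (ret \<infinity>)"
| "dist_to_list d p (q # qs) = tick (do {
     e \<leftarrow> query d p q;
     e' \<leftarrow> dist_to_list d p qs;
     ret (min (ereal e) e') })"

fun diversity_list :: "('a \<Rightarrow> 'a \<Rightarrow> real) \<Rightarrow> 'a list \<Rightarrow> ereal timed" where
  "diversity_list d [] = tick (ret \<infinity>)"
| "diversity_list d (p # ps) = tick (do {
     e \<leftarrow> dist_to_list d p ps;
     e' \<leftarrow> diversity_list d ps;
     ret (min e e') })"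

fun best_fair ::
  "('a \<Rightarrow> 'a \<Rightarrow> real) \<Rightarrow> nat list \<Rightarrow> (nat \<times> 'a) list list \<Rightarrow> (ereal \<times> 'a list) option timed" where
  "best_fair d ks [] = tick (ret None)"
| "best_fair d ks (S # Ss) = tick (do {
     best \<leftarrow> best_fair d ks Ss;
     f \<leftarrow> check_fair 0 ks S;
     if f
     then do {
       P \<leftarrow> map_timed snd S;
       e \<leftarrow> diversity_list d P;
       ret (case best of
              None \<Rightarrow> Some (e, P)
            | Some (e', P') \<Rightarrow> if e' < e then Some (e, P) else Some (e', P')) }
     else ret best })"

text \<open>The input consists of one list of points and one requirement for each group. The
  coreset size \<open>(4 / \<epsilon>') ^ \<lambda> * k\<close> need not be an integer and is rounded up.\<close>

definition coreset_size :: "real \<Rightarrow> nat \<Rightarrow> nat \<Rightarrow> nat" where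
  "coreset_size eps lam k = (let eps' = eps / (1 + eps) in nat \<lceil>(4 / eps') ^ lam * real k\<rceil>)"

definition fair_max_min ::
  "('a \<Rightarrow> 'a \<Rightarrow> real) \<Rightarrow> real \<Rightarrow> nat \<Rightarrow> 'a list list \<Rightarrow> nat list \<Rightarrow> 'a list option timed" where
  "fair_max_min d eps lam Xs ks = tick (do {
     k \<leftarrow> sum_timed ks;
     T \<leftarrow> coreset d (coreset_size eps lam k) 0 Xs;
     Ss \<leftarrow> subsets T;
     best \<leftarrow> best_fair d ks Ss;
     ret (map_option snd best) })"

end

theory Submission
  imports Defs
begin

text \<open>Let \<open>\<ell>\<close> be the optimal diversity. Either the greedy selection of a group covers the group at
  radius \<open>\<epsilon>' \<ell> / 2\<close>, or it has the full size \<open>(4 / \<epsilon>') ^ \<lambda> * k\<close> and is separated by more than that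
  radius. In the groups of the first kind the optimal points are moved to nearby coreset points,
  which shrinks distances by at most \<open>\<epsilon>' \<ell>\<close>. In the others, a ball of radius \<open>\<ell>\<close> contains at most
  \<open>(4 / \<epsilon>') ^ \<lambda>\<close> coreset points, so fewer than \<open>k\<close> selected points cannot block all of them, and a
  maximal extension is fair. GMM costs \<open>O(n k)\<close>, and the enumeration depends only on the
  coreset size, which is \<open>O(k)\<close>.\<close>

subsection \<open>Values and costs of the procedures\<close>

lemma fst_ret [simp]: "fst (ret x) = x" and snd_ret [simp]: "snd (ret x) = 0"
  by (simp_all add: ret_def)

lemma fst_tick [simp]: "fst (tick c) = fst c" and snd_tick [simp]: "snd (tick c) = Suc (snd c)"
  by (simp_all add: tick_def)

lemma fst_bind_timed [simp]: "fst (bind_timed c f) = fst (f (fst c))"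
  and snd_bind_timed [simp]: "snd (bind_timed c f) = snd c + snd (f (fst c))"
  by (simp_all add: bind_timed_def)

lemma fst_query [simp]: "fst (query d p q) = d p q" and snd_query [simp]: "snd (query d p q) = 1"
  by (simp_all add: query_def)

lemma fst_map_timed [simp]: "fst (map_timed f xs) = map f xs"
  and snd_map_timed [simp]: "snd (map_timed f xs) = Suc (length xs)"
  by (induction xs) auto

lemma fst_append_timed [simp]: "fst (append_timed xs ys) = xs @ ys"
  and snd_append_timed [simp]: "snd (append_timed xs ys) = Suc (length xs)"
  by (induction xs) auto

lemma fst_sum_timed [simp]: "fst (sum_timed xs) = sum_list xs"
  and snd_sum_timed [simp]: "snd (sum_timed xs) = Suc (length xs)"
  by (induction xs) auto

section \<open>Greedy selection: extracting the maximum, relaxing distances, the GMM loop\<close>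

lemma mset_extract_max:
  "mset (fst (fst (extract_max b cs)) # snd (fst (extract_max b cs))) = mset (b # cs)"
  by (induction b cs rule: extract_max.induct) (auto simp: split_beta add_mset_commute)

lemma length_extract_max [simp]: "length (snd (fst (extract_max b cs))) = length cs"
  by (metis length_Cons mset_extract_max nat.inject size_mset)

lemma extract_max_ge:
  "c \<in> set (b # cs) \<Longrightarrow> snd c \<le> snd (fst (fst (extract_max b cs)))"
proof (induction b cs arbitrary: c rule: extract_max.induct)
  case (2 b c' cs)
  show ?case
  proof (cases "snd b < snd c'")
    case True
    then have "snd c' \<le> snd (fst (fst (extract_max c' cs)))" "c \<noteq> b \<Longrightarrow> ?thesis"
      using 2 by (auto simp: split_beta)
    then show ?thesis
      using True by (cases "c = b") (auto simp: split_beta)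
  next
    case False
    then have "snd b \<le> snd (fst (fst (extract_max b cs)))" "c \<noteq> c' \<Longrightarrow> ?thesis"
      using 2 by (auto simp: split_beta)
    then show ?thesis
      using False by (cases "c = c'") (auto simp: split_beta)
  qed
qed auto

lemma snd_extract_max [simp]: "snd (extract_max b cs) = Suc (length cs)"
  by (induction b cs rule: extract_max.induct) (auto simp: split_beta)

lemma fst_relax [simp]: "fst (relax d p cs) = map (\<lambda>(q, e). (q, min e (ereal (d p q)))) cs"
  and snd_relax [simp]: "snd (relax d p cs) = Suc (2 * length cs)"
  by (induction cs) auto

text \<open>Extraction permutes the entries and relaxation changes only the stored distances, so a
  selected point never occurs again. Each round removes one entry, which gives the length.\<close>

lemma gmm_loop_distinct:
  assumes "distinct (map fst cs)"
  shows "distinct (fst (gmm_loop d s cs)) \<and> set (fst (gmm_loop d s cs)) \<subseteq> fst ` set cs \<and>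
    length (fst (gmm_loop d s cs)) = min s (length cs)"
  using assms
proof (induction d s cs rule: gmm_loop.induct)
  case (3 d s c cs)
  obtain p e rest where ex: "fst (extract_max c cs) = ((p, e), rest)"
    by (metis prod.exhaust)
  have ms: "mset ((p, e) # rest) = mset (c # cs)"
    using mset_extract_max[of c cs] ex by simp
  have len: "length rest = length cs"
    using length_extract_max[of c cs] ex by simp
  have "mset (map fst ((p, e) # rest)) = mset (map fst (c # cs))"
    using ms by (metis mset_map)
  then have dis: "distinct (map fst ((p, e) # rest))"
    using "3.prems" mset_eq_imp_distinct_iff by blast
  have st: "set ((p, e) # rest) = set (c # cs)"
    using ms mset_eq_setD by blast
  define rest' where "rest' = fst (relax d p rest)"
  have fr: "map fst rest' = map fst rest"
    by (auto simp: split_beta rest'_def)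
  then have fr': "fst ` set rest' = fst ` set rest"
    by (metis list.set_map)
  have len': "length rest' = length rest"
    by (simp add: rest'_def)
  have out: "fst (gmm_loop d (Suc s) (c # cs)) = p # fst (gmm_loop d s rest')"
    using ex by (simp add: rest'_def)
  have IH: "distinct (fst (gmm_loop d s rest'))"
    "set (fst (gmm_loop d s rest')) \<subseteq> fst ` set rest'"
    "length (fst (gmm_loop d s rest')) = min s (length rest')"
    using "3.IH"[of rest'] dis unfolding fr by auto
  have "fst ` set (c # cs) = insert p (fst ` set rest)"
    using arg_cong[OF st, of "image fst"] by simp
  then show ?case
    using IH dis len len' fr' unfolding out by auto
qed auto

text \<open>GMM selects a farthest point: once the next one is within \<open>r\<close> of the selection, so are all
  remaining points.\<close>

lemma gmm_loop_cover_or_separated: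
  assumes "distinct (map fst cs)" "0 \<le> r" "\<And>c. c \<in> set cs \<Longrightarrow> d (fst c) (fst c) = 0"
  shows "(\<forall>(q, e) \<in> set cs. e \<le> ereal r \<or> (\<exists>p \<in> set (fst (gmm_loop d s cs)). d p q \<le> r)) \<or>
    ((\<forall>(q, e) \<in> set cs. q \<in> set (fst (gmm_loop d s cs)) \<longrightarrow> ereal r < e) \<and>
     sorted_wrt (\<lambda>p q. r < d p q) (fst (gmm_loop d s cs)))"
  using assms
proof (induction d s cs rule: gmm_loop.induct)
  case (3 d s c cs)
  obtain p e rest where ex: "fst (extract_max c cs) = ((p, e), rest)"
    by (metis prod.exhaust)
  define rest' where "rest' = fst (relax d p rest)"
  define ps where "ps = fst (gmm_loop d s rest')"
  have out: "fst (gmm_loop d (Suc s) (c # cs)) = p # ps"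
    using ex by (simp add: ps_def rest'_def)
  have ms: "mset ((p, e) # rest) = mset (c # cs)"
    using mset_extract_max[of c cs] ex by simp
  have "mset (map fst ((p, e) # rest)) = mset (map fst (c # cs))"
    using ms by (metis mset_map)
  then have dis: "distinct (map fst ((p, e) # rest))"
    using "3.prems" mset_eq_imp_distinct_iff by blast
  have st: "set (c # cs) = set ((p, e) # rest)"
    using ms mset_eq_setD by metis
  have fr: "map fst rest' = map fst rest"
    by (auto simp: split_beta rest'_def)
  have r': "(q, min e' (ereal (d p q))) \<in> set rest'" if "(q, e') \<in> set rest" for q e'
    using that by (force simp: rest'_def)
  have psub: "set ps \<subseteq> fst ` set rest'"
    using gmm_loop_distinct[of rest' d s] dis fr by (simp add: ps_def)
  have dpp: "d p p = 0"
    using "3.prems"(3)[of "(p, e)"] unfolding st by simp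
  have emax: "e' \<le> e" if "(q, e') \<in> set (c # cs)" for q e'
    using extract_max_ge[OF that] ex by simp
  have zero: "d (fst x) (fst x) = 0" if "x \<in> set rest'" for x
  proof -
    have "fst x \<in> set (map fst rest)"
      using that fr by (metis list.set_map imageI)
    then obtain y where "y \<in> set rest" "fst y = fst x" by auto
    moreover from this have "y \<in> set (c # cs)" unfolding st by simp
    ultimately show ?thesis using "3.prems"(3)[of y] by simp
  qed
  \<comment> \<open>The induction hypothesis speaks about the relaxed list, whose stored distances
    already account for \<open>p\<close>; the rest translates it back to the distances before
    \<open>p\<close> was selected.\<close>
  have "(\<forall>(q, e) \<in> set rest'. e \<le> ereal r \<or> (\<exists>p \<in> set ps. d p q \<le> r)) \<or>
    ((\<forall>(q, e) \<in> set rest'. q \<in> set ps \<longrightarrow> ereal r < e) \<and> sorted_wrt (\<lambda>p q. r < d p q) ps)"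
    unfolding ps_def using "3.IH"[of rest'] dis "3.prems"(2) zero fr by simp
  then consider (cover) "\<forall>(q, e) \<in> set rest'. e \<le> ereal r \<or> (\<exists>p \<in> set ps. d p q \<le> r)"
    | (sep) "\<forall>(q, e) \<in> set rest'. q \<in> set ps \<longrightarrow> ereal r < e" "sorted_wrt (\<lambda>p q. r < d p q) ps"
    by blast
  then show ?case
  proof cases
    case cover
    \<comment> \<open>A relaxed distance of at most \<open>r\<close> means that the old one was
      small already or that \<open>p\<close> covers the entry. The entry of \<open>p\<close> is
      covered by \<open>p\<close> itself.\<close>
    have "e' \<le> ereal r \<or> (\<exists>p' \<in> set (p # ps). d p' q \<le> r)" if "(q, e') \<in> set (c # cs)" for q e'
    proof (cases "(q, e') \<in> set rest")
      case True
      then show ?thesis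
        using cover r'[OF True] by (fastforce simp: min_le_iff_disj)
    next
      case False
      then show ?thesis
        using that dpp "3.prems"(2) unfolding st by auto
    qed
    then show ?thesis unfolding out by blast
  next
    case sep
    show ?thesis
    \<comment> \<open>\<open>e\<close> is the largest stored distance. If it is at most
      \<open>r\<close>, earlier selections cover every entry, so the first alternative holds;
      otherwise \<open>p\<close> joins the separated points.\<close>
    proof (cases "e \<le> ereal r")
      case True
      then show ?thesis using emax by (blast intro: order_trans)
    next
      case False
      have far: "ereal r < e' \<and> r < d p q" if "(q, e') \<in> set rest" "q \<in> set ps" for q e'
        using sep(1) r'[OF that(1)] that(2) by fastforce
      have "r < d p q" if "q \<in> set ps" for q
      proof -
        have "q \<in> set (map fst rest)"
          using that psub fr by (metis list.set_map subsetD)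
        then show ?thesis using far that by auto
      qed
      moreover have "ereal r < e'" if "(q, e') \<in> set (c # cs)" "q \<in> set (p # ps)" for q e'
      proof (cases "(q, e') \<in> set rest")
        case True
        then have "q \<noteq> p" using dis by force
        then show ?thesis using far True that by auto
      next
        case n: False
        then show ?thesis
          using that False unfolding st by auto
      qed
      ultimately show ?thesis
        using sep(2) unfolding out by auto
    qed
  qed
qed auto

text \<open>Storing the distance to the selection makes each of the at most \<open>s\<close> rounds
  linear: one scan to extract and one to relax, the latter with one metric query per entry.\<close>

lemma snd_gmm_loop: "snd (gmm_loop d s cs) \<le> 4 * s * length cs + 1"
proof (induction d s cs rule: gmm_loop.induct)
  case (3 d s c cs)
  obtain p e rest where ex: "fst (extract_max c cs) = ((p, e), rest)"
    by (metis prod.exhaust)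
  have len: "length rest = length cs"
    using length_extract_max[of c cs] ex by simp
  have "snd (gmm_loop d s (fst (relax d p rest))) \<le> 4 * s * length (fst (relax d p rest)) + 1"
    using "3.IH"[of "fst (relax d p rest)"] ex by simp
  then show ?case
    using ex len by (simp add: algebra_simps)
qed auto

lemma snd_gmm: "snd (gmm d s ys) \<le> 5 * s * length ys + 3"
proof (cases s)
  case (Suc s')
  then show ?thesis
    using snd_gmm_loop[of d s "map (\<lambda>y. (y, \<infinity>)) ys"] by (simp add: gmm_def algebra_simps)
qed (simp add: gmm_def)

lemma gmm_distinct:
  assumes "distinct ys"
  shows "distinct (fst (gmm d s ys))" "set (fst (gmm d s ys)) \<subseteq> set ys"
    "length (fst (gmm d s ys)) = min s (length ys)"
proof -
  have "map fst (map (\<lambda>y. (y, \<infinity>::ereal)) ys) = ys"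
    by (simp add: comp_def)
  then show "distinct (fst (gmm d s ys))" "set (fst (gmm d s ys)) \<subseteq> set ys"
    "length (fst (gmm d s ys)) = min s (length ys)"
    using gmm_loop_distinct[of "map (\<lambda>y. (y, \<infinity>::ereal)) ys" d s] assms
    by (auto simp: gmm_def image_image)
qed

text \<open>If there are fewer than \<open>s\<close> points, all are selected and each covers
  itself. Otherwise the selection has full size, and the alternative for the loop applies.\<close>

lemma gmm_cover_or_separated:
  assumes "distinct ys" "0 \<le> r" "Metric_space M d" "set ys \<subseteq> M"
  shows "(\<forall>q \<in> set ys. \<exists>p \<in> set (fst (gmm d s ys)). d p q \<le> r) \<or>
    (s \<le> card (set (fst (gmm d s ys))) \<and>
     pairwise (\<lambda>p q. r < d p q) (set (fst (gmm d s ys))))"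
proof -
  interpret Metric_space M d by fact
  define T where "T = fst (gmm d s ys)"
  have T: "distinct T" "set T \<subseteq> set ys" "length T = min s (length ys)"
    using gmm_distinct[OF assms(1)] by (auto simp: T_def)
  have ref: "d y y = 0" if "y \<in> set ys" for y
    using that assms(4) by auto
  show ?thesis
  proof (cases "s \<le> length ys \<and> s \<noteq> 0")
    case False
    show ?thesis
    proof (cases "s = 0")
      case True
      then have "T = []" using T(3) by simp
      then show ?thesis using True by (simp add: T_def)
    next
      case n: False
      then have "card (set T) = card (set ys)"
        using T(1,3) False assms(1) by (simp add: distinct_card)
      then have "set T = set ys"
        using T(2) by (simp add: card_subset_eq)
      then show ?thesis
        unfolding T_def[symmetric] using ref assms(2) by force
    qed
  next
    case True
    have loop: "T = fst (gmm_loop d s (map (\<lambda>y. (y, \<infinity>)) ys))"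
      using True by (simp add: T_def gmm_def)
    \<comment> \<open>The initial distances are infinite, hence never at most \<open>r\<close>, so
      only genuine covering by selected points remains in the first alternative.\<close>
    have "(\<forall>q \<in> set ys. \<exists>p \<in> set T. d p q \<le> r) \<or> sorted_wrt (\<lambda>p q. r < d p q) T"
      using gmm_loop_cover_or_separated[of "map (\<lambda>y. (y, \<infinity>::ereal)) ys" r d s] assms(1,2) ref
      unfolding loop[symmetric] by (fastforce simp: comp_def)
    \<comment> \<open>Separation is known only in the order of selection; symmetry of the metric
      supplies the other order.\<close>
    moreover have "pairwise (\<lambda>p q. r < d p q) (set T)" if "sorted_wrt (\<lambda>p q. r < d p q) T"
    proof (rule pairwiseI)
      fix p q assume pq: "p \<in> set T" "q \<in> set T" "p \<noteq> q"
      then obtain i j where ij: "i < length T" "j < length T" "T ! i = p" "T ! j = q" "i \<noteq> j"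
        by (metis in_set_conv_nth)
      have "r < d p q \<or> r < d q p"
        using sorted_wrt_nth_less[OF that] ij by (metis nat_neq_iff)
      then show "r < d p q" by (simp add: commute)
    qed
    moreover have "s \<le> card (set T)"
      using T True by (simp add: distinct_card)
    ultimately show ?thesis
      unfolding T_def[symmetric] by blast
  qed
qed

section \<open>The tagged coreset: its elements, size and cost\<close>

lemma set_coreset:
  "set (fst (coreset d s i Ys)) =
    {(i + j, x) | j x. j < length Ys \<and> x \<in> set (fst (gmm d s (Ys ! j)))}"
proof (induction Ys arbitrary: i)
  case (Cons Y Ys)
  have "{(i + j, x) | j x. j < length (Y # Ys) \<and> x \<in> set (fst (gmm d s ((Y # Ys) ! j)))} =
    Pair i ` set (fst (gmm d s Y)) \<union>
    {(Suc i + j, x) | j x. j < length Ys \<and> x \<in> set (fst (gmm d s (Ys ! j)))}" (is "?A = ?B")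
  proof
    show "?A \<subseteq> ?B"
    proof
      fix z assume "z \<in> ?A"
      then obtain j x where "z = (i + j, x)" "j < length (Y # Ys)"
        "x \<in> set (fst (gmm d s ((Y # Ys) ! j)))" by blast
      then show "z \<in> ?B" by (cases j) auto
    qed
  next
    show "?B \<subseteq> ?A"
    proof
      fix z assume "z \<in> ?B"
      then consider x where "z = (i, x)" "x \<in> set (fst (gmm d s Y))"
        | j x where "z = (Suc i + j, x)" "j < length Ys" "x \<in> set (fst (gmm d s (Ys ! j)))"
        by blast
      then show "z \<in> ?A"
      proof cases
        case 1
        then have "z = (i + 0, x)" "0 < length (Y # Ys)"
          "x \<in> set (fst (gmm d s ((Y # Ys) ! 0)))" by auto
        then show ?thesis by blast
      next
        case (2 j x)
        then have "z = (i + Suc j, x)" "Suc j < length (Y # Ys)"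
          "x \<in> set (fst (gmm d s ((Y # Ys) ! Suc j)))" by auto
        then show ?thesis by blast
      qed
    qed
  qed
  then show ?case
    using Cons.IH[of "Suc i"] by simp
qed simp

lemma distinct_coreset:
  "\<forall>Y \<in> set Ys. distinct Y \<Longrightarrow> distinct (fst (coreset d s i Ys))"
proof (induction Ys arbitrary: i)
  case (Cons Y Ys)
  then show ?case
    by (auto simp: distinct_map gmm_distinct set_coreset intro: inj_onI)
qed simp

lemma length_gmm_le: "length (fst (gmm d s ys)) \<le> s"
proof -
  have "length (fst (gmm_loop d s cs)) \<le> s" for cs
    by (induction d s cs rule: gmm_loop.induct) (auto simp: split_beta)
  then show ?thesis by (simp add: gmm_def)
qed

lemma length_coreset: "length (fst (coreset d s i Ys)) \<le> s * length Ys"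
proof (induction Ys arbitrary: i)
  case (Cons Y Ys)
  show ?case
    using length_gmm_le[of d s Y] Cons.IH[of "Suc i"] by simp
qed simp

text \<open>Besides the GMM call, each group pays for tagging and appending at most \<open>s\<close>
  points, whence the term \<open>2 * s\<close>.\<close>

lemma snd_coreset:
  "snd (coreset d s i Ys) \<le> 5 * s * sum_list (map length Ys) + length Ys * (6 + 2 * s) + 1"
proof (induction Ys arbitrary: i)
  case (Cons Y Ys)
  show ?case
    using length_gmm_le[of d s Y] snd_gmm[of d s Y] Cons.IH[of "Suc i"]
    by (simp add: algebra_simps)
qed simp

section \<open>Enumeration of subsets, the fairness test and the diversity of a list\<close>

lemma fst_subsets [simp]: "fst (subsets xs) = subseqs xs"
  by (induction xs) (auto simp: Let_def)

lemma snd_subsets: "snd (subsets xs) \<le> 5 * 2 ^ length xs"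
proof -
  \<comment> \<open>Doubling preserves the first summand and each element adds an overhead of 3, so
    this sharper bound is inductive. The linear part is absorbed afterwards by
    \<open>n < 2 ^ n\<close>.\<close>
  have "snd (subsets xs) \<le> 2 * 2 ^ length xs + 3 * length xs"
    by (induction xs) (auto simp: length_subseqs)
  also have "\<dots> \<le> 5 * 2 ^ length xs"
    using less_exp[of "length xs"] by linarith
  finally show ?thesis .
qed

text \<open>This locates a given set of points in the enumeration: filter the coreset list by
  membership.\<close>

lemma filter_in_subseqs: "filter P xs \<in> set (subseqs xs)"
  by (induction xs) (auto simp: Let_def)

lemma distinct_map_subseqs:
  "ys \<in> set (subseqs xs) \<Longrightarrow> distinct (map f xs) \<Longrightarrow> distinct (map f ys) \<and> set ys \<subseteq> set xs"
  by (induction xs arbitrary: ys) (fastforce simp: Let_def)+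

lemma length_subseqs_le: "ys \<in> set (subseqs xs) \<Longrightarrow> length ys \<le> length xs"
  by (induction xs arbitrary: ys) (fastforce simp: Let_def)+

lemma fst_count_group [simp]: "fst (count_group i S) = length (filter (\<lambda>p. fst p = i) S)"
  and snd_count_group [simp]: "snd (count_group i S) = Suc (length S)"
  by (induction S) auto

lemma fst_check_fair:
  "fst (check_fair i ks S) \<longleftrightarrow> (\<forall>j < length ks. ks ! j \<le> fst (count_group (i + j) S))"
proof (induction ks arbitrary: i)
  case (Cons k ks)
  then show ?case
    by (auto simp: less_Suc_eq_0_disj simp del: fst_count_group)
qed simp

lemma snd_check_fair [simp]: "snd (check_fair i ks S) = length ks * (length S + 2) + 1"
  by (induction ks arbitrary: i) auto

lemma fst_dist_to_list [simp]: "fst (dist_to_list d p qs) = (INF q \<in> set qs. ereal (d p q))"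
  by (induction qs) (auto simp: inf_min top_ereal_def)

lemma snd_dist_to_list [simp]: "snd (dist_to_list d p qs) = 2 * length qs + 1"
  by (induction qs) auto

lemma snd_diversity_list: "snd (diversity_list d ps) \<le> 2 * (length ps + 1) ^ 2"
  by (induction ps) (auto simp: power2_eq_square)

text \<open>The list procedure visits each unordered pair once, while \<open>diversity\<close>
  ranges over ordered pairs. The pairs beginning with \<open>p\<close> and those ending with
  \<open>p\<close> contribute the same values by symmetry.\<close>

lemma fst_diversity_list:
  assumes "distinct ps" "Metric_space M d"
  shows "fst (diversity_list d ps) = diversity d (set ps)"
  using assms(1)
proof (induction ps)
  case Nil
  then show ?case by (simp add: diversity_def top_ereal_def)
next
  case (Cons p ps)
  interpret Metric_space M d by fact
  have "diversity d (set (p # ps)) =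
      (INF z \<in> (Pair p) ` set ps \<union> (\<lambda>q. (q, p)) ` set ps \<union>
        {(u, v). u \<in> set ps \<and> v \<in> set ps \<and> u \<noteq> v}. ereal (d (fst z) (snd z)))"
    using Cons.prems unfolding diversity_def split_beta
    by (intro arg_cong[where f = Inf] image_cong) auto
  also have "\<dots> = inf (INF q \<in> set ps. ereal (d p q)) (diversity d (set ps))"
    by (simp add: INF_union diversity_def split_beta image_image commute[of _ p])
  finally show ?case
    using Cons by (simp add: inf_min)
qed

lemma best_fair_None:
  "fst (best_fair d ks Ss) = None \<Longrightarrow> S \<in> set Ss \<Longrightarrow> \<not> fst (check_fair 0 ks S)"
  by (induction Ss) (auto split: option.splits if_splits)

lemma best_fair_Some:
  "fst (best_fair d ks Ss) = Some (e, P) \<Longrightarrow>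
    (\<exists>S \<in> set Ss. fst (check_fair 0 ks S) \<and> P = map snd S \<and> e = fst (diversity_list d P)) \<and>
    (\<forall>S \<in> set Ss. fst (check_fair 0 ks S) \<longrightarrow> fst (diversity_list d (map snd S)) \<le> e)"
proof (induction Ss arbitrary: e P)
  case (Cons S Ss)
  show ?case
  proof (cases "fst (best_fair d ks Ss)")
    case None
    then show ?thesis
      using Cons.prems best_fair_None[OF None] by (auto split: if_splits)
  next
    case (Some b)
    obtain e' P' where b: "fst (best_fair d ks Ss) = Some (e', P')"
      using Some by (cases b) auto
    note IH = Cons.IH[OF b]
    show ?thesis
    proof (cases "fst (check_fair 0 ks S)")
      case False
      then show ?thesis
        using Cons.prems IH b by simp
    next
      case fair: True
      define f where "f = fst (diversity_list d (map snd S))"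
      show ?thesis
      proof (cases "e' < f")
        case True
        then have "e = f" "P = map snd S"
          using Cons.prems b fair by (auto simp: f_def)
        moreover have "fst (diversity_list d (map snd S')) \<le> f"
          if "S' \<in> set Ss" "fst (check_fair 0 ks S')" for S'
          using IH True that by (meson less_imp_le order_trans)
        ultimately show ?thesis
          using fair f_def by simp
      next
        case False
        then have "e = e'" "P = P'"
          using Cons.prems b fair by (auto simp: f_def)
        then show ?thesis
          using IH False f_def by auto
      qed
    qed
  qed
qed simp

lemma snd_best_fair:
  assumes "\<forall>S \<in> set Ss. length S \<le> N"
  shows "snd (best_fair d ks Ss) \<le> length Ss * ((2 * length ks + 5) * (N + 1) ^ 2) + 1"
  using assms
proof (induction Ss)
  case (Cons S Ss)
  have l: "length S \<le> N" using Cons.prems by simp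
  have "snd (best_fair d ks (S # Ss)) \<le>
    snd (best_fair d ks Ss) + (length ks * (length S + 2) + 1) + (length S + 1) +
      2 * (length S + 1) ^ 2 + 1"
    using snd_diversity_list[of d "map snd S"] by (simp split: option.splits)
  also have "\<dots> \<le> snd (best_fair d ks Ss) + (length ks * (N + 2) + 1) + (N + 1) + 2 * (N + 1) ^ 2 + 1"
    using l by (intro add_mono mult_mono power_mono) auto
  also have "\<dots> \<le> snd (best_fair d ks Ss) + (2 * length ks + 5) * (N + 1) ^ 2"
  proof -
    \<comment> \<open>The coefficient \<open>2 * length ks\<close> comes from counting the groups,
      and \<open>5 = 3 + 2\<close> from the overhead \<open>N + 3\<close> and the quadratic
      diversity computation.\<close>
    have "length ks * (N + 2) \<le> length ks * (2 * (N + 1) ^ 2)"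
      by (intro mult_left_mono) (auto simp: power2_eq_square)
    moreover have "N + 3 \<le> 3 * (N + 1) ^ 2"
      by (auto simp: power2_eq_square)
    ultimately show ?thesis by (simp add: algebra_simps)
  qed
  finally show ?case using Cons by simp
qed simp

subsection \<open>Covering and packing\<close>

text \<open>Admissible radii satisfy \<open>r / r' \<ge> 2\<close>, so the bound grows with the
  exponent.\<close>

lemma covering_exponent_mono:
  assumes "covering_exponent M d lam" "lam \<le> lam'"
  shows "covering_exponent M d lam'"
  unfolding covering_exponent_def
proof (intro ballI allI impI)
  fix p and r r' :: real assume p: "p \<in> M" and r: "0 < r' \<and> r' \<le> r / 2"
  then obtain C where C: "C \<subseteq> M" "finite C" "real (card C) \<le> (r / r') ^ lam"
    "Metric_space.mball M d p r \<subseteq> (\<Union>c\<in>C. Metric_space.mball M d c r')"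
    using assms(1) unfolding covering_exponent_def by meson
  have "(r / r') ^ lam \<le> (r / r') ^ lam'"
    using r assms(2) by (intro power_increasing) (auto simp: field_simps)
  then show "\<exists>C\<subseteq>M. finite C \<and> real (card C) \<le> (r / r') ^ lam' \<and>
      Metric_space.mball M d p r \<subseteq> (\<Union>c\<in>C. Metric_space.mball M d c r')"
    using C by (intro exI[of _ C]) auto
qed

text \<open>All of \<open>M\<close> serves as the set of centres, since
  \<open>n \<le> 2 ^ n \<le> (r / r') ^ n\<close> for \<open>n = card M\<close>.\<close>

lemma covering_exponent_finite:
  assumes "Metric_space M d" "finite M"
  shows "covering_exponent M d (card M)"
  unfolding covering_exponent_def
proof (intro ballI allI impI exI[of _ M] conjI)
  interpret Metric_space M d by fact
  fix p and r r' :: real assume r: "0 < r' \<and> r' \<le> r / 2"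
  have "real (card M) \<le> 2 ^ card M"
    using less_exp[of "card M"] by (simp add: less_imp_le)
  also have "\<dots> \<le> (r / r') ^ card M"
    using r by (intro power_mono) (auto simp: field_simps)
  finally show "real (card M) \<le> (r / r') ^ card M" .
next
  interpret Metric_space M d by fact
  fix p and r r' :: real assume r: "0 < r' \<and> r' \<le> r / 2"
  show "mball x s \<subseteq> (\<Union>c\<in>M. mball c r')" for x s
    using r by force
qed (use assms in auto)

text \<open>\<open>doubling_dim\<close> is a \<open>LEAST\<close>, hence meaningful only because some exponent exists.\<close>

lemma covering_exponent_doubling_dim:
  assumes "Metric_space M d" "finite M" "doubling_dim M d \<le> lam"
  shows "covering_exponent M d lam"
proof (rule covering_exponent_mono[OF _ assms(3)])
  show "covering_exponent M d (doubling_dim M d)"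
    unfolding doubling_dim_def by (rule LeastI) (rule covering_exponent_finite[OF assms(1,2)])
qed

text \<open>Two points in one ball of radius \<open>r'\<close> are closer than
  \<open>2 * r'\<close>, so each covering ball holds at most one point of \<open>T\<close>; sending
  points to centres is injective.\<close>

lemma card_separated_in_ball_le:
  assumes "Metric_space M d" "covering_exponent M d lam" "p \<in> M" "0 < r'" "r' \<le> r / 2"
    and T: "T \<subseteq> M" "pairwise (\<lambda>x y. 2 * r' < d x y) T"
  shows "real (card {t \<in> T. d p t < r}) \<le> (r / r') ^ lam"
proof -
  interpret Metric_space M d by fact
  obtain C where C: "C \<subseteq> M" "finite C" "real (card C) \<le> (r / r') ^ lam"
    "mball p r \<subseteq> (\<Union>c\<in>C. mball c r')"
    using assms(2-5) unfolding covering_exponent_def by meson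
  have "\<forall>t. \<exists>c. t \<in> T \<longrightarrow> d p t < r \<longrightarrow> c \<in> C \<and> t \<in> mball c r'"
    using C(4) T(1) assms(3) by (auto simp: subset_iff)
  then obtain f where f: "\<And>t. t \<in> T \<Longrightarrow> d p t < r \<Longrightarrow> f t \<in> C \<and> t \<in> mball (f t) r'"
    by metis
  have "inj_on f {t \<in> T. d p t < r}"
  proof (rule inj_onI, rule ccontr)
    fix x y assume xy: "x \<in> {t \<in> T. d p t < r}" "y \<in> {t \<in> T. d p t < r}" "f x = f y" "x \<noteq> y"
    then have "2 * r' < d x y" using T(2) by (auto simp: pairwise_def)
    moreover have "d x y \<le> d (f x) x + d (f x) y"
      using xy f[of x] f[of y] triangle[of x "f x" y] by (simp add: commute)
    ultimately show False using xy f[of x] f[of y] by auto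
  qed
  then have "card {t \<in> T. d p t < r} \<le> card C"
    using f C(2) by (intro card_inj_on_le[of f]) auto
  then show ?thesis using C(3) by linarith
qed

text \<open>Each \<open>u \<in> U\<close> rules out at most \<open>(r / r') ^ lam\<close> points of
  \<open>T\<close>, so by the union bound \<open>U\<close> cannot rule out all of them.\<close>

lemma exists_far_point:
  assumes M: "Metric_space M d" "covering_exponent M d lam" "0 < r'" "r' \<le> r / 2"
    and T: "T \<subseteq> M" "pairwise (\<lambda>x y. 2 * r' < d x y) T"
    and U: "finite U" "U \<subseteq> M" "(r / r') ^ lam * real (card U) < real (card T)"
  obtains t where "t \<in> T" "\<And>u. u \<in> U \<Longrightarrow> r \<le> d u t"
proof -
  \<comment> \<open>An infinite set has \<open>card\<close> 0, which the strict inequality on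
    \<open>card T\<close> excludes.\<close>
  have "finite T" 
  proof (rule ccontr)
    assume "infinite T"
    then have "card T = 0" by simp
    moreover have "0 \<le> (r / r') ^ lam * real (card U)" using M(3,4) by simp
    ultimately show False using U(3) by simp
  qed
  have "\<exists>t \<in> T. \<forall>u \<in> U. r \<le> d u t"
  proof (rule ccontr)
    assume "\<not> ?thesis"
    then have sub: "T \<subseteq> (\<Union>u \<in> U. {t \<in> T. d u t < r})"
      by (auto simp: not_le)
    have "card T \<le> card (\<Union>u \<in> U. {t \<in> T. d u t < r})"
      using U(1) \<open>finite T\<close> by (intro card_mono[OF _ sub]) auto
    also have "\<dots> \<le> (\<Sum>u \<in> U. card {t \<in> T. d u t < r})"
      by (rule card_UN_le[OF U(1)])
    finally have "real (card T) \<le> (\<Sum>u \<in> U. real (card {t \<in> T. d u t < r}))"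
      unfolding of_nat_sum[symmetric] of_nat_le_iff .
    also have "\<dots> \<le> (\<Sum>u \<in> U. (r / r') ^ lam)"
    proof (rule sum_mono)
      fix u assume "u \<in> U"
      then have "u \<in> M" using U(2) by blast
      then show "real (card {t \<in> T. d u t < r}) \<le> (r / r') ^ lam"
        by (rule card_separated_in_ball_le[OF M(1,2) _ M(3,4) T])
    qed
    finally show False using U(3) by (simp add: mult.commute)
  qed
  then show ?thesis using that by blast
qed

text \<open>The balls of radius \<open>r' / 2\<close> around \<open>C\<close> are disjoint; compare volumes.\<close>

lemma card_separated_in_ball_euclidean_le:
  fixes C :: "'e::euclidean_space set"
  assumes C: "finite C" "C \<subseteq> ball p r" "pairwise (\<lambda>x y. r' \<le> dist x y) C" and r: "0 < r'" "0 < r"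
  shows "real (card C) \<le> (2 * r / r' + 1) ^ DIM('e)"
proof -
  have disj: "pairwise (\<lambda>x y. disjnt (ball x (r' / 2)) (ball y (r' / 2))) C"
    unfolding pairwise_def
  proof (intro ballI impI)
    fix x y assume "x \<in> C" "y \<in> C" "x \<noteq> y"
    then have "r' \<le> dist x y" using C(3) by (auto simp: pairwise_def)
    then show "disjnt (ball x (r' / 2)) (ball y (r' / 2))"
      by (simp add: disjnt_def disjoint_ballI)
  qed
  have fm: "ball c s \<in> fmeasurable lborel" for c :: 'e and s
    by (rule fmeasurableI[OF _ emeasure_lborel_ball_finite]) simp
  have "real (card C) * (unit_ball_vol (DIM('e)) * (r' / 2) ^ DIM('e)) =
      (\<Sum>c\<in>C. measure lborel (ball c (r' / 2)))"
    using r by (simp add: content_ball)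
  also have "\<dots> = measure lborel (\<Union>c\<in>C. ball c (r' / 2))"
    using disj C(1) fm by (intro measure_UNION'[symmetric])
  also have "\<dots> \<le> measure lborel (ball p (r + r' / 2))"
  proof (rule measure_mono_fmeasurable)
    show "(\<Union>c\<in>C. ball c (r' / 2)) \<subseteq> ball p (r + r' / 2)"
    proof
      fix x assume "x \<in> (\<Union>c\<in>C. ball c (r' / 2))"
      then obtain c where "c \<in> C" "dist c x < r' / 2" by auto
      then show "x \<in> ball p (r + r' / 2)"
        using C(2) dist_triangle[of p x c] by (auto simp: subset_iff)
    qed
  qed (auto simp: fm intro!: borel_open)
  also have "\<dots> = unit_ball_vol (DIM('e)) * ((2 * r / r' + 1) * (r' / 2)) ^ DIM('e)"
  proof -
    have eq: "(2 * r / r' + 1) * (r' / 2) = r + r' / 2"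
      using r by (simp add: field_simps)
    show ?thesis unfolding eq using r by (simp add: content_ball)
  qed
  also have "\<dots> = (2 * r / r' + 1) ^ DIM('e) * (unit_ball_vol (DIM('e)) * (r' / 2) ^ DIM('e))"
    by (simp only: power_mult_distrib mult_ac)
  finally show ?thesis
    using r by (simp add: mult_le_cancel_right_pos)
qed

text \<open>A maximal \<open>r'\<close>-separated subset of the ball is a set of centres, and the
  volume bound limits it to \<open>(2 * t + 1) ^ DIM('e)\<close> points with
  \<open>t = r / r'\<close>. For \<open>t \<ge> 2\<close> the base is at most \<open>t ^ 3\<close>,
  which explains the factor 3.\<close>

lemma covering_exponent_euclidean:
  fixes P :: "'e::euclidean_space set"
  assumes "finite P"
  shows "covering_exponent P dist (3 * DIM('e))"
  unfolding covering_exponent_def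
proof (intro ballI allI impI)
  fix p and r r' :: real assume p: "p \<in> P" and r: "0 < r' \<and> r' \<le> r / 2"
  interpret P: Metric_space P dist by (rule Met_TC.subspace) simp
  \<comment> \<open>Candidates are restricted to \<open>P\<close> because the covering centres must
    be points of the finite space itself.\<close>
  define F where "F = {C. C \<subseteq> P \<inter> ball p r \<and> pairwise (\<lambda>x y. r' \<le> dist x y) C}"
  have "finite F" by (rule finite_subset[of _ "Pow P"]) (use assms in \<open>auto simp: F_def\<close>)
  moreover have "{} \<in> F" by (simp add: F_def)
  ultimately obtain C where C: "C \<in> F" "\<And>D. D \<in> F \<Longrightarrow> C \<subseteq> D \<Longrightarrow> C = D"
    using finite_has_maximal[of F] by blast
  have "C \<subseteq> P" using C(1) by (auto simp: F_def)
  then have finC: "finite C" using assms by (rule finite_subset)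
  have "\<exists>c \<in> C. dist c q < r'" if q: "q \<in> P" "dist p q < r" for q
  proof (rule ccontr)
    assume "\<not> ?thesis"
    then have far: "\<And>c. c \<in> C \<Longrightarrow> r' \<le> dist c q" by (force simp: not_less)
    then have "q \<notin> C" using r by force
    moreover have "insert q C \<in> F"
      using C(1) q far by (auto simp: F_def pairwise_insert dist_commute)
    ultimately show False using C(2)[of "insert q C"] by blast
  qed
  then have "P.mball p r \<subseteq> (\<Union>c\<in>C. P.mball c r')"
    using C(1) by (auto simp: F_def subset_iff) 
  moreover have "real (card C) \<le> (r / r') ^ (3 * DIM('e))"
  proof -
    define t where "t = r / r'"
    have t: "2 \<le> t" using r by (simp add: t_def field_simps)
    have "2 * t + 1 \<le> t * t * t"
    proof -
      have "2 * 2 * t \<le> t * t * t" using t by (intro mult_mono) auto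
      then show ?thesis using t by linarith
    qed
    then have "(2 * t + 1) ^ DIM('e) \<le> (t ^ 3) ^ DIM('e)"
      using t by (intro power_mono) (auto simp: power3_eq_cube)
    moreover have "real (card C) \<le> (2 * t + 1) ^ DIM('e)"
      using card_separated_in_ball_euclidean_le[of C p r r'] C(1) r finC by (simp add: F_def t_def)
    ultimately show ?thesis by (simp add: t_def power_mult)
  qed
  ultimately show "\<exists>C\<subseteq>P. finite C \<and> real (card C) \<le> (r / r') ^ (3 * DIM('e)) \<and>
      Metric_space.mball P dist p r \<subseteq> (\<Union>c\<in>C. Metric_space.mball P dist c r')"
    using \<open>C \<subseteq> P\<close> finC by blast
qed

subsection \<open>The approximate solution inside the coreset\<close>

lemma card_eq_sum_groups:
  assumes "finite U" "U \<subseteq> ground m X" "disjoint_family_on X {..<m}"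
  shows "card U = (\<Sum>i<m. card (U \<inter> X i))"
proof -
  have "U = (\<Union>i\<in>{..<m}. U \<inter> X i)" using assms(2) by (auto simp: ground_def)
  then have "card U = card (\<Union>i\<in>{..<m}. U \<inter> X i)" by simp
  also have "\<dots> = (\<Sum>i<m. card (U \<inter> X i))"
    using assms(1,3) by (intro card_UN_disjoint) (auto simp: disjoint_family_on_def)
  finally show ?thesis .
qed

text \<open>The greedy algorithm enters only through the alternative in the last hypothesis. A
  maximal separated set, with exact counts in the covered groups and bounded counts elsewhere, is
  shown to be fair.\<close>

lemma coreset_contains_good_solution:
  fixes X T :: "nat \<Rightarrow> 'a set" and m :: nat
  defines "M \<equiv> ground m X"
  assumes M: "Metric_space M d" "covering_exponent M d lam" "finite M"
    and X: "disjoint_family_on X {..<m}"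
    and eps: "0 < eps" "0 < l"
    and S: "S \<subseteq> M" "\<And>i. i < m \<Longrightarrow> card (S \<inter> X i) = k i" "pairwise (\<lambda>u v. l \<le> d u v) S"
    and TX: "\<And>i. i < m \<Longrightarrow> T i \<subseteq> X i"
    and s: "(4 / (eps / (1 + eps))) ^ lam * real (\<Sum>i<m. k i) \<le> real s"
    and T: "\<And>i. i < m \<Longrightarrow> (\<forall>q \<in> X i. \<exists>p \<in> T i. d p q \<le> eps / (1 + eps) * l / 2) \<or>
      (s \<le> card (T i) \<and> pairwise (\<lambda>p q. eps / (1 + eps) * l / 2 < d p q) (T i))"
  obtains U where "U \<subseteq> (\<Union>i<m. T i)" "\<And>i. i < m \<Longrightarrow> card (U \<inter> X i) = k i"
    "pairwise (\<lambda>u v. l / (1 + eps) \<le> d u v) U"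
proof -
  interpret Metric_space M d by fact
  define e where "e = eps / (1 + eps)"
  define l' where "l' = l / (1 + eps)"
  \<comment> \<open>Since \<open>1 / (1 + eps) = 1 - e\<close>, the target \<open>l'\<close> is
    exactly \<open>l\<close> minus two displacements of \<open>e * l / 2\<close>.\<close>
  have e: "0 < e" "e < 1" "l' = l - e * l" "0 < l'" "l' \<le> l"
    using eps by (auto simp: e_def l'_def field_simps)
  have XM: "X i \<subseteq> M" if "i < m" for i
    using that by (auto simp: M_def ground_def)
  have X': "i = j" if "x \<in> X i" "x \<in> X j" "i < m" "j < m" for x i j
    using X that by (auto simp: disjoint_family_on_def)
  define G where "G = {i. i < m \<and> (\<forall>q \<in> X i. \<exists>p \<in> T i. d p q \<le> e * l / 2)}"
  \<comment> \<open>The groups are disjoint, so \<open>q\<close> determines its group and one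
    function \<open>f\<close> can serve all covered groups at once.\<close>
  have "\<exists>p. \<forall>i \<in> G. q \<in> X i \<longrightarrow> p \<in> T i \<and> d p q \<le> e * l / 2" for q
  proof (cases "\<exists>i \<in> G. q \<in> X i")
    case True
    then obtain i where i: "i \<in> G" "q \<in> X i" by blast
    then obtain p where "p \<in> T i" "d p q \<le> e * l / 2" by (auto simp: G_def)
    then show ?thesis using i X' by (metis (mono_tags, lifting) G_def mem_Collect_eq)
  qed blast
  then obtain f where f: "\<And>q i. i \<in> G \<Longrightarrow> q \<in> X i \<Longrightarrow> f q \<in> T i \<and> d (f q) q \<le> e * l / 2"
    by metis
  define A where "A = f ` (\<Union>i \<in> G. S \<inter> X i)"
  \<comment> \<open>The groups may be equal or different. Besides the separation of
    \<open>A\<close>, this yields injectivity of \<open>f\<close> on each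
    \<open>S \<inter> X i\<close>, and with it the counts of \<open>A\<close>.\<close>
  have fdist: "l' \<le> d (f x) (f y)" if "x \<in> S \<inter> X i" "y \<in> S \<inter> X j" "i \<in> G" "j \<in> G" "x \<noteq> y" for x y i j
  proof -
    have ij: "i < m" "j < m" using that by (auto simp: G_def)
    have in_M: "f x \<in> M" "f y \<in> M" "x \<in> M" "y \<in> M"
      using f that TX XM ij by (blast+)
    have "l \<le> d x y" using S(3) that by (auto simp: pairwise_def)
    also have "\<dots> \<le> d x (f x) + (d (f x) (f y) + d (f y) y)"
      using triangle[of x "f x" y] triangle[of "f x" "f y" y] in_M by linarith
    finally show ?thesis
      using f[of i x] f[of j y] that commute[of x "f x"] e(3) by auto
  qed
  \<comment> \<open>Counts are exact on \<open>G\<close>, so a deficit in a maximal member can only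
    occur in a group whose coreset part is large and separated.\<close>
  define F where "F = {U. U \<subseteq> (\<Union>i<m. T i) \<and> (\<forall>i<m. card (U \<inter> X i) \<le> k i) \<and>
    (\<forall>i\<in>G. card (U \<inter> X i) = k i) \<and> pairwise (\<lambda>u v. l' \<le> d u v) U}"
  have TM: "(\<Union>i<m. T i) \<subseteq> M" using TX XM by blast
  have "finite F"
    by (rule finite_subset[of _ "Pow M"]) (use M(3) TM in \<open>auto simp: F_def\<close>)
  moreover have "A \<in> F"
  proof -
    have AX: "A \<inter> X i = (if i \<in> G then f ` (S \<inter> X i) else {})" if i: "i < m" for i
    proof -
      have fX: "f q \<in> X i \<longleftrightarrow> j = i" if "j \<in> G" "q \<in> X j" for j q
      proof -
        have "j < m" using that by (simp add: G_def)
        moreover from this have "f q \<in> X j" using f[OF that] TX by blast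
        ultimately show ?thesis using X' i by blast
      qed
      have "A \<inter> X i = f ` (\<Union>j \<in> G \<inter> {i}. S \<inter> X j)"
        unfolding A_def using fX by blast
      then show ?thesis by simp
    qed
    have "inj_on f (S \<inter> X i)" if "i \<in> G" for i
    proof (rule inj_onI, rule ccontr)
      fix x y assume xy: "x \<in> S \<inter> X i" "y \<in> S \<inter> X i" "f x = f y" "x \<noteq> y"
      then have "l' \<le> d (f x) (f x)" using fdist[of x i y i] that by auto
      moreover have "f x \<in> M" using f[OF that] xy TM that by (auto simp: G_def)
      ultimately show False using e(4) by simp
    qed
    then have cardA: "card (A \<inter> X i) = (if i \<in> G then k i else 0)" if "i < m" for i
      using AX[OF that] S(2)[OF that] by (auto simp: card_image)
    have "A \<subseteq> (\<Union>i<m. T i)" using f by (force simp: A_def G_def)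
    moreover have "pairwise (\<lambda>u v. l' \<le> d u v) A"
      using fdist unfolding A_def pairwise_def by blast
    ultimately show ?thesis using cardA by (auto simp: F_def G_def)
  qed
  ultimately obtain U where U: "U \<in> F" "\<And>V. V \<in> F \<Longrightarrow> U \<subseteq> V \<Longrightarrow> U = V"
    using finite_has_maximal[of F] by blast
  have UM: "U \<subseteq> M" using U(1) TM by (auto simp: F_def)
  have finU: "finite U" using UM M(3) finite_subset by blast
  have cardU: "card U = (\<Sum>i<m. card (U \<inter> X i))"
    using card_eq_sum_groups[OF finU _ X] UM by (simp add: M_def)
  have "card (U \<inter> X i) = k i" if i: "i < m" for i
  proof (rule ccontr)
    assume neq: "card (U \<inter> X i) \<noteq> k i"
    then have lt: "card (U \<inter> X i) < k i" using U(1) i by (force simp: F_def)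
    have iG: "i \<notin> G" using U(1) neq by (auto simp: F_def)
    then have Ti: "s \<le> card (T i)" "pairwise (\<lambda>p q. e * l / 2 < d p q) (T i)"
      using T[OF i] i by (auto simp: G_def e_def)
    have "card U < (\<Sum>i<m. k i)"
      unfolding cardU using U(1) i lt by (intro sum_strict_mono_ex1) (auto simp: F_def)
    \<comment> \<open>The packing radii are \<open>r = l\<close> and \<open>r' = e * l / 4\<close>:
      then \<open>2 * r'\<close> is the separation of \<open>T i\<close>, and \<open>r / r'\<close>
      is the base in the coreset size.\<close>
    moreover have "l / (e * l / 4) = 4 / e" using eps by simp
    moreover have "(4 / e) ^ lam > 0" using e by simp
    ultimately have "(l / (e * l / 4)) ^ lam * real (card U) < (4 / e) ^ lam * real (\<Sum>i<m. k i)"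
      by (metis mult_strict_left_mono of_nat_less_iff)
    also have "\<dots> \<le> real (card (T i))" using s Ti(1) by (simp add: e_def)
    finally have *: "(l / (e * l / 4)) ^ lam * real (card U) < real (card (T i))" .
    have TiM: "T i \<subseteq> M" using i TM by blast
    obtain t where t: "t \<in> T i" "\<And>u. u \<in> U \<Longrightarrow> l \<le> d u t"
      by (rule exists_far_point[OF M(1,2) _ _ TiM _ finU UM *]) (use e eps Ti(2) in auto)
    have tM: "t \<in> M" and tX: "t \<in> X i" using t TiM TX[OF i] by auto
    have tU: "t \<notin> U" using t(2)[of t] tM eps by auto
    have cardV: "card (insert t U \<inter> X j) = (if j = i then Suc (card (U \<inter> X i)) else card (U \<inter> X j))"
      if "j < m" for j
    proof (cases "j = i")
      case True
      then have "insert t U \<inter> X j = insert t (U \<inter> X i)" using tX by auto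
      then show ?thesis using tU True finU by simp
    next
      case False
      then have "insert t U \<inter> X j = U \<inter> X j" using tX X' i that by blast
      then show ?thesis using False by simp
    qed
    have "pairwise (\<lambda>u v. l' \<le> d u v) (insert t U)"
      using U(1) t(2) e(5) commute[of t] by (fastforce simp: F_def pairwise_insert)
    then have "insert t U \<in> F"
      using U(1) t(1) i lt iG by (auto simp: F_def cardV G_def)
    then show False using U(2)[of "insert t U"] tU by blast
  qed
  then show ?thesis using that[of U] U(1) by (auto simp: F_def l'_def)
qed

subsection \<open>Running time\<close>

text \<open>At most \<open>2 ^ N\<close> subsets, with \<open>N = m * s\<close>, are tested at
  quadratic cost each. Bounding the quadratic factor by \<open>4 ^ N\<close> gives base 8; all costs
  except the leading GMM term are absorbed there.\<close>

lemma snd_fair_max_min: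
  fixes eps :: real and lam :: nat
  assumes "length ks = length Xs"
  defines "s \<equiv> coreset_size eps lam (sum_list ks)" and "m \<equiv> length Xs"
  shows "snd (fair_max_min d eps lam Xs ks) \<le>
    5 * s * sum_list (map length Xs) + (9 * m + 16) * 8 ^ (m * s)"
proof -
  define L where "L = fst (coreset d s 0 Xs)"
  define N where "N = m * s"
  have LN: "length L \<le> N"
    using length_coreset[of d s 0 Xs] by (simp add: L_def N_def m_def mult.commute)
  then have N8: "8 ^ length L \<le> (8::nat) ^ N"
    by (intro power_increasing) auto
  have "snd (best_fair d ks (subseqs L)) \<le> 2 ^ length L * ((2 * m + 5) * (length L + 1) ^ 2) + 1"
    using snd_best_fair[of "subseqs L" "length L" d ks] length_subseqs_le assms(1)
    by (auto simp: length_subseqs m_def)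
  also have "\<dots> \<le> 2 ^ length L * ((2 * m + 5) * (2 ^ length L) ^ 2) + 1"
  proof -
    have "length L + 1 \<le> 2 ^ length L"
      using less_exp[of "length L"] by linarith
    then show ?thesis by (intro add_right_mono mult_left_mono power_mono) auto
  qed
  also have "\<dots> = (2 * m + 5) * 8 ^ length L + 1"
  proof -
    have "(8::nat) ^ length L = (2 ^ 3) ^ length L" by simp
    also have "\<dots> = (2 ^ length L) ^ 3" by (simp only: power_mult[symmetric] mult.commute)
    finally show ?thesis by (simp add: power2_eq_square power3_eq_cube)
  qed
  also have "\<dots> \<le> (2 * m + 5) * 8 ^ N + 1"
    using N8 by (intro add_right_mono mult_left_mono) auto
  finally have best: "snd (best_fair d ks (subseqs L)) \<le> (2 * m + 5) * 8 ^ N + 1" .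
  have "(2::nat) ^ length L \<le> 8 ^ length L" by (intro power_mono) auto
  then have sub: "snd (subsets L) \<le> 5 * 8 ^ N"
    using snd_subsets[of L] N8 by linarith
  have core: "snd (coreset d s 0 Xs) \<le> 5 * s * sum_list (map length Xs) + 6 * m + 2 * N + 1"
    using snd_coreset[of d s 0 Xs] by (simp add: m_def N_def algebra_simps)
  have "N < 2 ^ N" by (rule less_exp)
  also have "2 ^ N \<le> (8::nat) ^ N" by (intro power_mono) auto
  finally have N: "N \<le> 8 ^ N" by simp
  have one: "7 * m + 4 \<le> (7 * m + 4) * 8 ^ N" by simp
  have "snd (fair_max_min d eps lam Xs ks) =
      2 + m + snd (coreset d s 0 Xs) + snd (subsets L) + snd (best_fair d ks (subseqs L))"
    using assms(1) by (simp add: fair_max_min_def s_def[symmetric] L_def m_def)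
  also have "\<dots> \<le> 2 + m + (5 * s * sum_list (map length Xs) + 6 * m + 2 * N + 1) + 5 * 8 ^ N +
      ((2 * m + 5) * 8 ^ N + 1)"
    using best sub core by linarith
  also have "\<dots> \<le> 5 * s * sum_list (map length Xs) + (9 * m + 16) * 8 ^ N"
  proof -
    \<comment> \<open>The four shares pay for the constant and per-group overhead, the handling of
      \<open>2 * N\<close> coreset entries, the enumeration, and the search for the best
      subset.\<close>
    have "(9 * m + 16) * (8::nat) ^ N =
        (7 * m + 4) * 8 ^ N + 2 * 8 ^ N + 5 * 8 ^ N + (2 * m + 5) * 8 ^ N"
      by (simp add: algebra_simps)
    then show ?thesis using N one by linarith
  qed
  finally show ?thesis by (simp add: N_def)
qed

text \<open>The lower bound feeds the packing argument, the upper one the running time. Rounding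
  adds at most 1, which is at most \<open>k\<close> for positive \<open>k\<close>; for
  \<open>k = 0\<close> the size is 0.\<close>

lemma coreset_size_bounds:
  fixes eps :: real and lam :: nat
  assumes "0 < eps"
  defines "a \<equiv> (4 / (eps / (1 + eps))) ^ lam"
  shows "a * real k \<le> real (coreset_size eps lam k)"
    "real (coreset_size eps lam k) \<le> (a + 1) * real k"
proof -
  have a: "0 \<le> a * real k" using assms by simp
  then have s: "real (coreset_size eps lam k) = real_of_int \<lceil>a * real k\<rceil>"
    by (simp add: coreset_size_def a_def Let_def)
  then show "a * real k \<le> real (coreset_size eps lam k)" by simp
  show "real (coreset_size eps lam k) \<le> (a + 1) * real k"
  proof (cases k)
    case (Suc k')
    have "real_of_int \<lceil>a * real k\<rceil> \<le> a * real k + 1" by linarith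
    also have "\<dots> \<le> (a + 1) * real k" using Suc by (simp add: algebra_simps)
    finally show ?thesis using s by simp
  qed (simp add: coreset_size_def)
qed

subsection \<open>Correctness\<close>

text \<open>With two points present, the infimum ranges over a nonempty finite set of pairs, so a
  closest pair attains it and it is a positive real.\<close>

lemma diversity_pairwise:
  assumes "Metric_space M d" "finite S" "S \<subseteq> M" "card S > 1"
  obtains l where "0 < l" "diversity d S = ereal l" "pairwise (\<lambda>u v. l \<le> d u v) S"
proof -
  interpret Metric_space M d by fact
  define Q where "Q = {(u, v). u \<in> S \<and> v \<in> S \<and> u \<noteq> v}"
  have "finite Q" by (rule finite_subset[of _ "S \<times> S"]) (use assms(2) in \<open>auto simp: Q_def\<close>)
  moreover have "Q \<noteq> {}"
    using card_le_Suc0_iff_eq[OF assms(2)] assms(4) by (auto simp: Q_def)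
  ultimately have "\<exists>z \<in> Q. \<forall>w \<in> Q. d (fst z) (snd z) \<le> d (fst w) (snd w)"
    using arg_min_if_finite[of Q "\<lambda>z. d (fst z) (snd z)"] by (meson not_le)
  then obtain u v where uv: "(u, v) \<in> Q" "\<And>w. w \<in> Q \<Longrightarrow> d u v \<le> d (fst w) (snd w)"
    by (metis prod.collapse)
  have "diversity d S = ereal (d u v)"
    unfolding diversity_def Q_def[symmetric] split_beta
    by (rule antisym) (use uv in \<open>auto intro: INF_lower2 INF_greatest\<close>)
  moreover have "0 < d u v" using uv(1) assms(3) by (intro mdist_pos_less) (auto simp: Q_def)
  moreover have "pairwise (\<lambda>x y. d u v \<le> d x y) S"
    using uv(2) by (auto simp: pairwise_def Q_def)
  ultimately show ?thesis using that by blast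
qed

text \<open>\<open>Max\<close> is meaningful only on a nonempty finite set. A feasible set is the
  union of arbitrary \<open>k i\<close>-subsets of the groups, which exist because
  \<open>k i \<le> card (X i)\<close>.\<close>

lemma opt_diversity_attained:
  assumes "fair_instance m d X k"
  obtains S where "S \<subseteq> ground m X" "\<And>i. i < m \<Longrightarrow> card (S \<inter> X i) = k i"
    "diversity d S = opt_diversity m d X k"
proof -
  let ?F = "{S. S \<subseteq> ground m X \<and> (\<forall>i<m. card (S \<inter> X i) = k i)}"
  have fin: "finite (ground m X)" and dis: "disjoint_family_on X {..<m}"
    and k: "\<And>i. i < m \<Longrightarrow> k i \<le> card (X i)"
    using assms by (auto simp: fair_instance_def)
  have "\<forall>i. \<exists>A. i < m \<longrightarrow> A \<subseteq> X i \<and> card A = k i"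
    using k obtain_subset_with_card_n by metis
  then obtain A where A: "\<And>i. i < m \<Longrightarrow> A i \<subseteq> X i \<and> card (A i) = k i" by metis
  have "(\<Union>i<m. A i) \<inter> X j = A j" if "j < m" for j
  proof -
    have "x \<in> A j" if x: "x \<in> A i" "x \<in> X j" "i < m" for x i
    proof -
      have "x \<in> X i" using A x by blast
      then have "i = j" using dis x \<open>j < m\<close> by (auto simp: disjoint_family_on_def)
      then show ?thesis using x by simp
    qed
    then show ?thesis using A that by blast
  qed
  then have "(\<Union>i<m. A i) \<in> ?F"
    using A by (auto simp: ground_def)
  moreover have "finite ?F" using fin by simp
  ultimately have "opt_diversity m d X k \<in> diversity d ` ?F"
    unfolding opt_diversity_def by (intro Max_in) blast+
  then show ?thesis using that by auto
qed

lemma coreset_contains_approximation: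
  fixes eps :: real and lam :: nat
  assumes inst: "fair_instance m d X k" and dim: "doubling_dim (ground m X) d \<le> lam"
    and eps: "0 < eps"
    and Xs: "\<And>i. i < m \<Longrightarrow> distinct (Xs ! i) \<and> set (Xs ! i) = X i"
  defines "T \<equiv> \<lambda>i. set (fst (gmm d (coreset_size eps lam (\<Sum>i<m. k i)) (Xs ! i)))"
  obtains U where "U \<subseteq> (\<Union>i<m. T i)" "\<And>i. i < m \<Longrightarrow> card (U \<inter> X i) = k i"
    "opt_diversity m d X k / ereal (1 + eps) \<le> diversity d U"
proof -
  define M where "M = ground m X"
  have fin: "finite M" and dis: "disjoint_family_on X {..<m}" and met: "Metric_space M d"
    using inst by (auto simp: fair_instance_def M_def)
  have XM: "X i \<subseteq> M" if "i < m" for i using that by (auto simp: M_def ground_def)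
  have cov: "covering_exponent M d lam"
    using covering_exponent_doubling_dim[OF met fin] dim by (simp add: M_def)
  have TX: "T i \<subseteq> X i" if "i < m" for i
    using gmm_distinct(2) Xs[OF that] unfolding T_def by metis
  obtain S where S: "S \<subseteq> M" "\<And>i. i < m \<Longrightarrow> card (S \<inter> X i) = k i"
    "diversity d S = opt_diversity m d X k"
    using opt_diversity_attained[OF inst] by (auto simp: M_def)
  have finS: "finite S" using S(1) fin by (rule finite_subset)
  \<comment> \<open>The separation \<open>l\<close> is kept arbitrary so that the case of infinite
    optimal diversity can reuse this fact.\<close>
  have ex: "\<exists>U. U \<subseteq> (\<Union>i<m. T i) \<and> (\<forall>i<m. card (U \<inter> X i) = k i) \<and>
    pairwise (\<lambda>u v. l / (1 + eps) \<le> d u v) U"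
    if l: "0 < l" "pairwise (\<lambda>u v. l \<le> d u v) S" for l
  proof -
    have r: "0 \<le> eps / (1 + eps) * l / 2" using eps l by simp
    have TT: "(\<forall>q \<in> X i. \<exists>p \<in> T i. d p q \<le> eps / (1 + eps) * l / 2) \<or>
      (coreset_size eps lam (\<Sum>i<m. k i) \<le> card (T i) \<and>
       pairwise (\<lambda>p q. eps / (1 + eps) * l / 2 < d p q) (T i))" if "i < m" for i
      using gmm_cover_or_separated[OF _ r met, of "Xs ! i"] Xs[OF that] XM[OF that]
      unfolding T_def by metis
    show ?thesis
      by (rule coreset_contains_good_solution[OF met[unfolded M_def] cov[unfolded M_def]
          fin[unfolded M_def] dis eps l(1) S(1)[unfolded M_def] S(2) l(2) TX
          coreset_size_bounds(1)[OF eps] TT]) blast+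
  qed
  show ?thesis
  proof (cases "card S > 1")
    case True
    obtain l where l: "0 < l" "diversity d S = ereal l" "pairwise (\<lambda>u v. l \<le> d u v) S"
      using diversity_pairwise[OF met finS S(1) True] by metis
    obtain U where U: "U \<subseteq> (\<Union>i<m. T i)" "\<forall>i<m. card (U \<inter> X i) = k i"
      "pairwise (\<lambda>u v. l / (1 + eps) \<le> d u v) U"
      using ex[OF l(1,3)] by blast
    have "ereal (l / (1 + eps)) \<le> diversity d U"
      unfolding diversity_def using U(3) by (intro INF_greatest) (auto simp: pairwise_def)
    then show ?thesis using that[of U] U l(2) S(3) eps by auto
  next
    case False
    \<comment> \<open>With at most one point the optimum is infinite and every separation holds
      vacuously; 1 is an arbitrary positive choice. The resulting \<open>U\<close> is as small as
      \<open>S\<close>, hence also of infinite diversity.\<close>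
    then have "pairwise (\<lambda>u v. 1 \<le> d u v) S"
      using card_le_Suc0_iff_eq[OF finS] by (auto simp: pairwise_def)
    then obtain U where U: "U \<subseteq> (\<Union>i<m. T i)" "\<forall>i<m. card (U \<inter> X i) = k i"
      using ex[of 1] by auto
    have UM: "U \<subseteq> M" using U(1) TX XM by blast
    then have finU: "finite U" using fin by (rule finite_subset)
    have "card U = card S"
      using card_eq_sum_groups[OF finU _ dis] card_eq_sum_groups[OF finS _ dis] UM S(1,2) U(2)
      by (simp add: M_def)
    then have "{(u, v). u \<in> U \<and> v \<in> U \<and> u \<noteq> v} = {}"
      using card_le_Suc0_iff_eq[OF finU] False by auto
    then have "diversity d U = \<infinity>" unfolding diversity_def by (simp only:) (simp add: top_ereal_def)
    then show ?thesis using that[of U] U by auto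
  qed
qed

text \<open>The good subset \<open>U\<close> of the coreset occurs in the enumeration and passes the
  fairness test, so the returned list is at least as diverse.\<close>

lemma fair_max_min_correct:
  assumes inst: "fair_instance m d X k" and dim: "doubling_dim (ground m X) d \<le> lam"
    and eps: "0 < eps" and len: "length Xs = m"
    and Xs: "\<And>i. i < m \<Longrightarrow> distinct (Xs ! i) \<and> set (Xs ! i) = X i"
  shows "\<exists>P. fst (fair_max_min d eps lam Xs (map k [0..<m])) = Some P \<and>
    set P \<subseteq> ground m X \<and> opt_diversity m d X k / ereal (1 + eps) \<le> diversity d (set P) \<and>
    (\<forall>i<m. k i \<le> card (set P \<inter> X i))"
proof -
  define s where "s = coreset_size eps lam (\<Sum>i<m. k i)"
  define T where "T = (\<lambda>i. set (fst (gmm d s (Xs ! i))))"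
  define L where "L = fst (coreset d s 0 Xs)"
  define ks where "ks = map k [0..<m]"
  have dis: "disjoint_family_on X {..<m}" and met: "Metric_space (ground m X) d"
    using inst by (auto simp: fair_instance_def)
  have X': "i = j" if "x \<in> X i" "x \<in> X j" "i < m" "j < m" for x i j
    using dis that by (auto simp: disjoint_family_on_def)
  have TX: "T i \<subseteq> X i" if "i < m" for i
    using gmm_distinct(2) Xs[OF that] unfolding T_def by metis
  then have TX': "x \<in> X i" if "i < m" "x \<in> T i" for x i
    using that by blast
  have setL: "set L = {(j, x) | j x. j < m \<and> x \<in> T j}"
    by (simp add: L_def set_coreset T_def len)
  have "distinct L"
    using Xs len unfolding L_def by (intro distinct_coreset) (auto simp: in_set_conv_nth)
  \<comment> \<open>A point determines its tag because the groups are disjoint. Hence dropping tags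
    creates no duplicates, and counting tags is counting points of a group.\<close>
  moreover have "inj_on snd (set L)"
  proof (rule inj_onI)
    fix p q assume pq: "p \<in> set L" "q \<in> set L" "snd p = snd q"
    then have "fst p < m" "snd p \<in> X (fst p)" "fst q < m" "snd q \<in> X (fst q)"
      using TX' unfolding setL by auto
    then show "p = q" using pq(3) X' by (intro prod_eqI) auto
  qed
  ultimately have dL: "distinct (map snd L)" by (simp add: distinct_map)
  have sub: "distinct (map snd S) \<and> set S \<subseteq> set L" if "S \<in> set (subseqs L)" for S
    using distinct_map_subseqs[OF that dL] by blast
  have count: "fst (count_group i S) = card (set (map snd S) \<inter> X i)"
    if S: "S \<in> set (subseqs L)" and i: "i < m" for S i
  proof -
    have "distinct (map snd (filter (\<lambda>p. fst p = i) S))"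
      using sub[OF S] distinct_map_filter by blast
    then have "fst (count_group i S) = card (set (map snd (filter (\<lambda>p. fst p = i) S)))"
      by (simp only: distinct_card length_map fst_count_group)
    also have "set (map snd (filter (\<lambda>p. fst p = i) S)) = set (map snd S) \<inter> X i"
    proof -
      have "fst p = i \<longleftrightarrow> snd p \<in> X i" if "p \<in> set S" for p
      proof -
        have "fst p < m" "snd p \<in> X (fst p)"
          using that sub[OF S] TX' unfolding setL by auto
        then show ?thesis using X' i by auto
      qed
      then show ?thesis by auto
    qed
    finally show ?thesis .
  qed
  have fair: "fst (check_fair 0 ks S) \<longleftrightarrow> (\<forall>i<m. k i \<le> card (set (map snd S) \<inter> X i))"
    if "S \<in> set (subseqs L)" for S
    using count[OF that] by (auto simp: fst_check_fair ks_def simp del: fst_count_group)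
  obtain U where U: "U \<subseteq> (\<Union>i<m. T i)" "\<And>i. i < m \<Longrightarrow> card (U \<inter> X i) = k i"
    "opt_diversity m d X k / ereal (1 + eps) \<le> diversity d U"
    using coreset_contains_approximation[OF inst dim eps Xs] unfolding T_def s_def by metis
  define V where "V = filter (\<lambda>p. snd p \<in> U) L"
  have V: "V \<in> set (subseqs L)" unfolding V_def by (rule filter_in_subseqs)
  have VU: "set (map snd V) = U"
    using U(1) by (force simp: V_def setL)
  have fairV: "fst (check_fair 0 ks V)" using fair[OF V] U(2) VU by simp
  obtain e P where eP: "fst (best_fair d ks (subseqs L)) = Some (e, P)"
    using best_fair_None[OF _ V] fairV by (metis not_Some_eq surj_pair)
  obtain S where S: "S \<in> set (subseqs L)" "fst (check_fair 0 ks S)" "P = map snd S"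
    "e = fst (diversity_list d P)" "fst (diversity_list d (map snd V)) \<le> e"
    using best_fair_Some[OF eP] V fairV by blast
  have div: "fst (diversity_list d (map snd S')) = diversity d (set (map snd S'))"
    if "S' \<in> set (subseqs L)" for S'
    using sub[OF that] met by (intro fst_diversity_list) auto
  have "diversity d U \<le> diversity d (set P)"
    using S(3-5) div[OF V] div[OF S(1)] VU by simp
  moreover have "set P \<subseteq> ground m X"
    using S(3) sub[OF S(1)] TX' unfolding setL ground_def by fastforce
  moreover have "fst (fair_max_min d eps lam Xs ks) = Some P"
  proof -
    have "sum_list ks = (\<Sum>i<m. k i)"
      by (simp add: ks_def interv_sum_list_conv_sum_set_nat lessThan_atLeast0)
    then show ?thesis using eP by (simp add: fair_max_min_def L_def s_def)
  qed
  ultimately show ?thesis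
    using U(3) fair[OF S(1)] S(2,3) order_trans unfolding ks_def by blast
qed

section \<open>Explicit constants for the running time, and Euclidean point sets\<close>

theorem mainTheorem7:
  shows
    "(\<forall>(m::nat) (lam::nat) (eps::real). 0 < eps \<and> eps \<le> 1 \<longrightarrow>
       (\<exists>(c::real) (g::nat \<Rightarrow> real). g \<in> O(\<lambda>j. real j) \<and>
         (\<forall>(d::'a \<Rightarrow> 'a \<Rightarrow> real) (X::nat \<Rightarrow> 'a set) (k::nat \<Rightarrow> nat) (Xs::'a list list).
            fair_instance m d X k \<and> doubling_dim (ground m X) d \<le> lam \<and>
            length Xs = m \<and> (\<forall>i<m. distinct (Xs ! i) \<and> set (Xs ! i) = X i) \<longrightarrow>
            (\<exists>S. fst (fair_max_min d eps lam Xs (map k [0..<m])) = Some S \<and>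
                 set S \<subseteq> ground m X \<and>
                 diversity d (set S) \<ge> opt_diversity m d X k / ereal (1 + eps) \<and>
                 (\<forall>i<m. card (set S \<inter> X i) \<ge> k i)) \<and>
            real (snd (fair_max_min d eps lam Xs (map k [0..<m])))
              \<le> c * real (card (ground m X)) * real (\<Sum>i<m. k i) + 2 powr g (\<Sum>i<m. k i))))
     \<and> (\<exists>lam. \<forall>P::'e::euclidean_space set. finite P \<longrightarrow> doubling_dim P dist \<le> lam)"
proof (intro conjI allI impI)
  fix m lam :: nat and eps :: real
  assume eps: "0 < eps \<and> eps \<le> 1"
  define a where "a = (4 / (eps / (1 + eps))) ^ lam"
  \<comment> \<open>The GMM term is \<open>5 * s * n\<close> with
    \<open>s \<le> (a + 1) * K\<close>, where \<open>K\<close> is the sum of the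
    requirements.\<close>
  define c where "c = 5 * (a + 1)"
  \<comment> \<open>The logarithm turns the factor \<open>9 * m + 16\<close> into a power of 2, and
    the linear term comes from \<open>8 ^ (m * s) = 2 ^ (3 * m * s)\<close>.\<close>
  define g where "g = (\<lambda>j. log 2 (9 * real m + 16) + 3 * real m * (a + 1) * real j)"
  have a: "0 \<le> a" using eps by (simp add: a_def)
  have "g \<in> O(\<lambda>j. real j)"
  proof (rule bigoI[where c = "log 2 (9 * real m + 16) + 3 * real m * (a + 1)"])
    have log: "0 \<le> log 2 (9 * real m + 16)" by simp
    \<comment> \<open>The constant logarithm is dominated by a multiple of \<open>j\<close> only
      from \<open>j = 1\<close> on, which suffices for an eventual bound.\<close>
    have "norm (g j) \<le> (log 2 (9 * real m + 16) + 3 * real m * (a + 1)) * norm (real j)"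
      if "1 \<le> j" for j
    proof -
      have "log 2 (9 * real m + 16) * 1 \<le> log 2 (9 * real m + 16) * real j"
        using log that by (intro mult_left_mono) auto
      moreover have "0 \<le> 3 * real m * (a + 1) * real j" using a by simp
      ultimately have "g j \<le> (log 2 (9 * real m + 16) + 3 * real m * (a + 1)) * real j" "0 \<le> g j"
        using log unfolding g_def distrib_right by linarith+
      then show ?thesis by simp
    qed
    then show "\<forall>\<^sub>F j in sequentially. norm (g j) \<le>
        (log 2 (9 * real m + 16) + 3 * real m * (a + 1)) * norm (real j)"
      using eventually_ge_at_top by (rule eventually_mono[rotated])
  qed
  moreover have "real (snd (fair_max_min d eps lam Xs (map k [0..<m])))
      \<le> c * real (card (ground m X)) * real (\<Sum>i<m. k i) + 2 powr g (\<Sum>i<m. k i)"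
    if inst: "fair_instance m d X k" and len: "length Xs = m"
      and Xs: "\<forall>i<m. distinct (Xs ! i) \<and> set (Xs ! i) = X i"
    for d :: "'a \<Rightarrow> 'a \<Rightarrow> real" and X k Xs
  proof -
    define K where "K = (\<Sum>i<m. k i)"
    define s where "s = coreset_size eps lam K"
    have fin: "finite (ground m X)" and dis: "disjoint_family_on X {..<m}"
      using inst by (auto simp: fair_instance_def)
    have s: "real s \<le> (a + 1) * real K"
      using coreset_size_bounds(2)[of eps lam K] eps by (simp add: s_def a_def)
    have "sum_list (map length Xs) = (\<Sum>i<m. length (Xs ! i))"
      using len by (simp add: sum_list_sum_nth lessThan_atLeast0)
    also have "\<dots> = (\<Sum>i<m. card (ground m X \<inter> X i))"
    proof (rule sum.cong)
      fix i assume i: "i \<in> {..<m}"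
      then have "ground m X \<inter> X i = X i" by (auto simp: ground_def)
      then show "length (Xs ! i) = card (ground m X \<inter> X i)"
        using Xs i distinct_card[of "Xs ! i"] by simp
    qed simp
    also have "\<dots> = card (ground m X)"
      using card_eq_sum_groups[OF fin subset_refl dis] by simp
    finally have n: "sum_list (map length Xs) = card (ground m X)" .
    have "sum_list (map k [0..<m]) = K"
      by (simp add: K_def interv_sum_list_conv_sum_set_nat lessThan_atLeast0)
    then have "snd (fair_max_min d eps lam Xs (map k [0..<m])) \<le>
        5 * s * card (ground m X) + (9 * m + 16) * 8 ^ (m * s)"
      using snd_fair_max_min[of "map k [0..<m]" Xs d eps lam] len n by (simp add: s_def)
    then have "real (snd (fair_max_min d eps lam Xs (map k [0..<m]))) \<le>
        real (5 * s * card (ground m X) + (9 * m + 16) * 8 ^ (m * s))"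
      by (rule of_nat_mono)
    also have "\<dots> = 5 * real s * real (card (ground m X)) + (9 * real m + 16) * 8 ^ (m * s)"
      by simp
    also have "\<dots> \<le> c * real (card (ground m X)) * real K + 2 powr g K"
    proof (rule add_mono)
      have "5 * real s * real (card (ground m X)) \<le> 5 * ((a + 1) * real K) * real (card (ground m X))"
        using s by (intro mult_right_mono mult_left_mono) auto
      then show "5 * real s * real (card (ground m X)) \<le> c * real (card (ground m X)) * real K"
        by (simp add: c_def mult_ac)
      have "(8::real) ^ (m * s) = 2 powr (3 * real m * real s)"
      proof -
        have "(8::real) ^ (m * s) = (2 ^ 3) ^ (m * s)" by simp
        also have "\<dots> = 2 ^ (3 * (m * s))" by (simp only: power_mult)
        also have "\<dots> = 2 powr real (3 * (m * s))" by (rule powr_realpow[symmetric]) simp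
        finally show ?thesis by (simp add: mult.assoc)
      qed
      also have "\<dots> \<le> 2 powr (3 * real m * ((a + 1) * real K))"
        using s by (intro powr_mono mult_left_mono) auto
      finally have "(9 * real m + 16) * 8 ^ (m * s) \<le>
          (9 * real m + 16) * 2 powr (3 * real m * ((a + 1) * real K))"
        by (intro mult_left_mono) auto
      also have "\<dots> = 2 powr g K"
        by (simp add: g_def powr_add mult.assoc)
      finally show "(9 * real m + 16) * 8 ^ (m * s) \<le> 2 powr g K" .
    qed
    finally show ?thesis by (simp add: K_def)
  qed
  ultimately show "\<exists>(c::real) (g::nat \<Rightarrow> real). g \<in> O(\<lambda>j. real j) \<and>
         (\<forall>(d::'a \<Rightarrow> 'a \<Rightarrow> real) (X::nat \<Rightarrow> 'a set) (k::nat \<Rightarrow> nat) (Xs::'a list list).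
            fair_instance m d X k \<and> doubling_dim (ground m X) d \<le> lam \<and>
            length Xs = m \<and> (\<forall>i<m. distinct (Xs ! i) \<and> set (Xs ! i) = X i) \<longrightarrow>
            (\<exists>S. fst (fair_max_min d eps lam Xs (map k [0..<m])) = Some S \<and>
                 set S \<subseteq> ground m X \<and>
                 diversity d (set S) \<ge> opt_diversity m d X k / ereal (1 + eps) \<and>
                 (\<forall>i<m. card (set S \<inter> X i) \<ge> k i)) \<and>
            real (snd (fair_max_min d eps lam Xs (map k [0..<m])))
              \<le> c * real (card (ground m X)) * real (\<Sum>i<m. k i) + 2 powr g (\<Sum>i<m. k i))"
    using fair_max_min_correct eps by (intro exI[of _ c] exI[of _ g]) blast
next
  show "\<exists>lam. \<forall>P::'e set. finite P \<longrightarrow> doubling_dim P dist \<le> lam"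
    \<comment> \<open>The witness \<open>3 * DIM('e)\<close> is uniform in \<open>P\<close>, and
      \<open>LEAST\<close> is at most any valid exponent.\<close>
    unfolding doubling_dim_def using covering_exponent_euclidean by (blast intro: Least_le)
qed

end
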